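(* Let $\mathbb F$ be a field, let $m>n\ge r$, let $X=(X_{i,j})_{i\in[m],j\in[n]}$ be a matrix of distinct indeterminates, and let $A^{bd}=\mathbb F[\{X_{i,j}\}]$ with its bideterminant ASL structure. Let $I_r\subseteq A^{bd}$ be the ideal generated by the size-$r$ minors of $X$. Then $$G_r:=\{M_{S,T} : S\subseteq[m],\ T\subseteq[n],\ n\ge|S|=|T|\ge r\}$$ is a universal bd-Gröbner basis for $I_r$; that is, $G_r$ is a pseudo-ASL Gröbner basis of $I_r$ with respect to every pseudo-ASL term order $\preceq$ on $A^{bd}$ and every algebra of leading terms $A^{bd}_{lt}$ for $(A^{bd},\preceq)$. Here $M_{S,T}$ is the minor of $X$ with row set $S$ and column set $T$.
   Context: Bideterminant structure: $H$ is the set of all minors (of all sizes $\ge1$) of $X$. For minors with increasing row indices $a_1<\dots<a_p$ and column indices $b_1<\dots<b_p$, written $(a_1,\dots,a_p\,|\,b_1,\dots,b_p)$, put $(a_1,\dots,a_p|b_1,\dots,b_p)\le(c_1,\dots,c_q|d_1,\dots,d_q)$ iff $p\ge q$ and $a_i\le c_i$, $b_i\le d_i$ for all $i\le q$. A monomial in the minors is a standard bideterminant if its minor factors are pairwise comparable; $\Sigma\subseteq\mathbb W^H$ is the set of non-standard monomials in the minors ($\mathbb W=\{0,1,2,\dots\}$). It is classical that the standard bideterminants form an $\mathbb F$-basis of $\mathbb F[X]$, so $A^{bd}=(\mathbb F[X],H,\Sigma)$ is a pseudo-ASL in the following sense. Pseudo-ASL over a field $R$: a triple $(A,H,\Sigma)$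 with $A$ a commutative $R$-algebra, $H\subseteq A$ a finite generating set, $\Sigma$ an ideal of the monoid $\mathbb W^H$ of monomials on $H$ (a subset closed under multiplication by all monomials) with $H\cap\Sigma=\emptyset$, such that the elements $\prod_{h}h^{m(h)}$, $m\in\mathbb W^H\setminus\Sigma$ (the standard monomials), form an $R$-basis of $A$. Given a total order on standard monomials, $LM(f)$ and $LT(f)$ are the leading standard monomial and leading term of $f$; $LT(0)=0$. Pseudo-ASL term order: a total order $\preceq$ on standard monomials such that $1\preceq u$ for all standard monomials $u$, and $LM(fh)\prec LM(gk)$ whenever $f,g,h,k$ are standard monomials with $f\prec g$, $h\preceq k$, $fh\ne0$, $gk\neq0$. Algebra of leading terms for $(A,\preceq)$: a pseudo-ASL $A_{lt}$ over $R$ with the same $(H,\Sigma)$ such that, with $\pi_{lt}:A\to A_{lt}$ the $R$-linear bijection that is the identity on standard monomials, $\pi_{lt}(u)\pi_{lt}(u')\in\{0,\pi_{lt}(LT(uu'))\}$ for all standard monomials $u,u'$. $G\subseteq I$ is a pseudo-ASL Gröbner basis of the ideal $I$ with respect to $(\preceq,A_{lt})$ if $\langle\pi_{lt}(LT(f)):f\in I\rangle=\langle\pi_{lt}(LT(g)):g\in G\rangle$ as ideals of $A_{lt}$. In $A^{bd}$ such a basis is called a bd-Gröbner basis. *)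

theory Defs
  imports
    "HOL-Library.Poly_Mapping"
    "HOL-Library.Multiset"
    "HOL-Library.Cardinality"
    "Jordan_Normal_Form.Determinant"
begin

section \<open>Pseudo-ASLs over a field\<close>

locale comm_algebra = Vector_Spaces.vector_space scale
  for scale :: "'k::field \<Rightarrow> 'a::comm_ring_1 \<Rightarrow> 'a" +
  assumes scale_mult: "scale c x * y = scale c (x * y)"

text \<open>
  The generating set is given by an index set \<open>H\<close> and a map \<open>g\<close> from \<open>H\<close> into the algebra, so that
  two algebras can carry the same \<open>(H, \<Sigma>)\<close>. The free commutative monoid on \<open>H\<close> is the set of
  multisets over \<open>H\<close>.
\<close>

definition monomials :: "'h set \<Rightarrow> 'h multiset set" where
  "monomials H = {u. set_mset u \<subseteq> H}"

definition mon_eval :: "('h \<Rightarrow> 'a::comm_ring_1) \<Rightarrow> 'h multiset \<Rightarrow> 'a" where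
  "mon_eval g u = prod_mset (image_mset g u)"

definition standard :: "'h set \<Rightarrow> 'h multiset set \<Rightarrow> 'h multiset set" where
  "standard H \<Sigma> = monomials H - \<Sigma>"

definition monoid_ideal :: "'h set \<Rightarrow> 'h multiset set \<Rightarrow> bool" where
  "monoid_ideal H \<Sigma> \<longleftrightarrow>
     \<Sigma> \<subseteq> monomials H \<and> (\<forall>u\<in>\<Sigma>. \<forall>v\<in>monomials H. u + v \<in> \<Sigma>)"

text \<open>
  The members of \<open>H\<close> are standard, so the basis condition also makes \<open>g\<close> injective on \<open>H\<close>.
\<close>

definition pseudo_ASL ::
  "('k::field \<Rightarrow> 'a::comm_ring_1 \<Rightarrow> 'a) \<Rightarrow> 'h set \<Rightarrow> ('h \<Rightarrow> 'a) \<Rightarrow> 'h multiset set \<Rightarrow> bool" where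
  "pseudo_ASL scale H g \<Sigma> \<longleftrightarrow>
     comm_algebra scale \<and>
     finite H \<and> Modules.module.span scale (mon_eval g ` monomials H) = UNIV \<and>
     monoid_ideal H \<Sigma> \<and> (\<forall>h\<in>H. {#h#} \<notin> \<Sigma>) \<and>
     inj_on (mon_eval g) (standard H \<Sigma>) \<and>
     \<not> Modules.module.dependent scale (mon_eval g ` standard H \<Sigma>) \<and>
     Modules.module.span scale (mon_eval g ` standard H \<Sigma>) = UNIV"

definition std_coeff ::
  "('k::field \<Rightarrow> 'a::comm_ring_1 \<Rightarrow> 'a) \<Rightarrow> 'h set \<Rightarrow> ('h \<Rightarrow> 'a) \<Rightarrow> 'h multiset set \<Rightarrow>
   'a \<Rightarrow> 'h multiset \<Rightarrow> 'k" where
  "std_coeff scale H g \<Sigma> f u =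
     Modules.module.representation scale (mon_eval g ` standard H \<Sigma>) f (mon_eval g u)"

text \<open>
  Orders are relations on the exponents of the standard monomials; \<open>(u, v) \<in> ord\<close> means that
  \<open>u\<close> is at most \<open>v\<close>. The value of \<open>LM\<close> at 0 is irrelevant.
\<close>

definition LM ::
  "('k::field \<Rightarrow> 'a::comm_ring_1 \<Rightarrow> 'a) \<Rightarrow> 'h set \<Rightarrow> ('h \<Rightarrow> 'a) \<Rightarrow> 'h multiset set \<Rightarrow>
   'h multiset rel \<Rightarrow> 'a \<Rightarrow> 'h multiset" where
  "LM scale H g \<Sigma> ord f =
     (THE u. u \<in> standard H \<Sigma> \<and> std_coeff scale H g \<Sigma> f u \<noteq> 0 \<and>
        (\<forall>v\<in>standard H \<Sigma>. std_coeff scale H g \<Sigma> f v \<noteq> 0 \<longrightarrow> (v, u) \<in> ord))"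

definition LT ::
  "('k::field \<Rightarrow> 'a::comm_ring_1 \<Rightarrow> 'a) \<Rightarrow> 'h set \<Rightarrow> ('h \<Rightarrow> 'a) \<Rightarrow> 'h multiset set \<Rightarrow>
   'h multiset rel \<Rightarrow> 'a \<Rightarrow> 'a" where
  "LT scale H g \<Sigma> ord f =
     (if f = 0 then 0
      else let u = LM scale H g \<Sigma> ord f in scale (std_coeff scale H g \<Sigma> f u) (mon_eval g u))"

definition pseudo_ASL_term_order ::
  "('k::field \<Rightarrow> 'a::comm_ring_1 \<Rightarrow> 'a) \<Rightarrow> 'h set \<Rightarrow> ('h \<Rightarrow> 'a) \<Rightarrow> 'h multiset set \<Rightarrow>
   'h multiset rel \<Rightarrow> bool" where
  "pseudo_ASL_term_order scale H g \<Sigma> ord \<longleftrightarrow>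
     linear_order_on (standard H \<Sigma>) ord \<and>
     (\<forall>u\<in>standard H \<Sigma>. ({#}, u) \<in> ord) \<and>
     (\<forall>f\<in>standard H \<Sigma>. \<forall>g'\<in>standard H \<Sigma>. \<forall>h\<in>standard H \<Sigma>. \<forall>k\<in>standard H \<Sigma>.
        (f, g') \<in> ord - Id \<and> (h, k) \<in> ord \<and>
        mon_eval g f * mon_eval g h \<noteq> 0 \<and> mon_eval g g' * mon_eval g k \<noteq> 0 \<longrightarrow>
        (LM scale H g \<Sigma> ord (mon_eval g f * mon_eval g h),
         LM scale H g \<Sigma> ord (mon_eval g g' * mon_eval g k)) \<in> ord - Id)"

definition leading_term_algebra ::
  "('k::field \<Rightarrow> 'a::comm_ring_1 \<Rightarrow> 'a) \<Rightarrow> 'h set \<Rightarrow> ('h \<Rightarrow> 'a) \<Rightarrow> 'h multiset set \<Rightarrow>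
   'h multiset rel \<Rightarrow> ('k \<Rightarrow> 'b::comm_ring_1 \<Rightarrow> 'b) \<Rightarrow> ('h \<Rightarrow> 'b) \<Rightarrow> ('a \<Rightarrow> 'b) \<Rightarrow> bool" where
  "leading_term_algebra scale H g \<Sigma> ord scale_lt g_lt \<pi> \<longleftrightarrow>
     pseudo_ASL scale_lt H g_lt \<Sigma> \<and>
     Vector_Spaces.linear scale scale_lt \<pi> \<and> bij \<pi> \<and>
     (\<forall>u\<in>standard H \<Sigma>. \<pi> (mon_eval g u) = mon_eval g_lt u) \<and>
     (\<forall>u\<in>standard H \<Sigma>. \<forall>u'\<in>standard H \<Sigma>.
        \<pi> (mon_eval g u) * \<pi> (mon_eval g u')
          \<in> {0, \<pi> (LT scale H g \<Sigma> ord (mon_eval g u * mon_eval g u'))})"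

text \<open>Ideals of a commutative ring are the submodules of the ring over itself.\<close>

definition ideal_span :: "'a::comm_ring_1 set \<Rightarrow> 'a set" where
  "ideal_span S = Modules.module.span (*) S"

definition pseudo_ASL_Groebner_basis ::
  "('k::field \<Rightarrow> 'a::comm_ring_1 \<Rightarrow> 'a) \<Rightarrow> 'h set \<Rightarrow> ('h \<Rightarrow> 'a) \<Rightarrow> 'h multiset set \<Rightarrow>
   'h multiset rel \<Rightarrow> ('a \<Rightarrow> 'b::comm_ring_1) \<Rightarrow> 'a set \<Rightarrow> 'a set \<Rightarrow> bool" where
  "pseudo_ASL_Groebner_basis scale H g \<Sigma> ord \<pi> I G \<longleftrightarrow>
     G \<subseteq> I \<and>
     ideal_span {\<pi> (LT scale H g \<Sigma> ord f) | f. f \<in> I} =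
     ideal_span {\<pi> (LT scale H g \<Sigma> ord f) | f. f \<in> G}"


section \<open>The bideterminant structure on the coordinate ring of a generic matrix\<close>

text \<open>
  Rows and columns are indexed by finite linearly ordered types \<open>'m\<close> and \<open>'n\<close>, of cardinalities
  \<open>m\<close> and \<open>n\<close>. The type below is the polynomial ring over \<open>'k\<close> in the variables \<open>'m \<times> 'n\<close>:
  finitely supported maps from exponent vectors to coefficients.
\<close>

type_synonym ('m, 'n, 'k) matrix_poly = "(('m \<times> 'n) \<Rightarrow>\<^sub>0 nat) \<Rightarrow>\<^sub>0 'k"

definition poly_scale :: "'k::field \<Rightarrow> ('m, 'n, 'k) matrix_poly \<Rightarrow> ('m, 'n, 'k) matrix_poly" where
  "poly_scale c p = Poly_Mapping.single 0 c * p"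

definition mat_var :: "'m \<Rightarrow> 'n \<Rightarrow> ('m, 'n, 'k::field) matrix_poly" where
  "mat_var i j = Poly_Mapping.single (Poly_Mapping.single (i, j) 1) 1"

text \<open>Only meant for sets \<open>S\<close> and \<open>T\<close> of equal cardinality.\<close>

definition minor ::
  "'m::{finite,linorder} set \<Rightarrow> 'n::{finite,linorder} set \<Rightarrow> ('m, 'n, 'k::field) matrix_poly" where
  "minor S T =
     det (mat (card S) (card T) (\<lambda>(i, j).
       mat_var (sorted_list_of_set S ! i) (sorted_list_of_set T ! j)))"

definition bd_H :: "('m::{finite,linorder} set \<times> 'n::{finite,linorder} set) set" where
  "bd_H = {(S, T). card S = card T \<and> 1 \<le> card S}"

definition bd_gen ::
  "'m::{finite,linorder} set \<times> 'n::{finite,linorder} set \<Rightarrow> ('m, 'n, 'k::field) matrix_poly" where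
  "bd_gen = (\<lambda>(S, T). minor S T)"

definition bd_le ::
  "'m::{finite,linorder} set \<times> 'n::{finite,linorder} set \<Rightarrow> 'm set \<times> 'n set \<Rightarrow> bool" where
  "bd_le = (\<lambda>(A, B) (C, D). card C \<le> card A \<and>
     (\<forall>i<card C. sorted_list_of_set A ! i \<le> sorted_list_of_set C ! i \<and>
                 sorted_list_of_set B ! i \<le> sorted_list_of_set D ! i))"

definition bd_Sigma :: "('m::{finite,linorder} set \<times> 'n::{finite,linorder} set) multiset set" where
  "bd_Sigma = {u \<in> monomials bd_H. \<exists>x\<in>#u. \<exists>y\<in>#u. \<not> bd_le x y \<and> \<not> bd_le y x}"

definition minor_ideal ::
  "nat \<Rightarrow> ('m::{finite,linorder}, 'n::{finite,linorder}, 'k::field) matrix_poly set" where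
  "minor_ideal r = ideal_span {minor S T | S T. card S = r \<and> card T = r}"

definition minors_ge ::
  "nat \<Rightarrow> ('m::{finite,linorder}, 'n::{finite,linorder}, 'k::field) matrix_poly set" where
  "minors_ge r =
     {minor S T | S T. card S = card T \<and> r \<le> card S \<and> card S \<le> CARD('n)}"

end

theory Submission
  imports Defs "HOL-Library.Product_Lexorder"
begin

text \<open>
  Everything rests on one fact about the ideal \<open>I\<close> of the \<open>r\<close>-minors, \<open>r \<ge> 1\<close>: every standard monomial
  that occurs in the standard expansion of an element of \<open>I\<close> has a factor of size at least \<open>r\<close>
  (lemma \<open>minor_ideal_support_has_large_minor\<close>). Whatever the order is, the leading standard monomial
  \<open>u\<close> of a nonzero \<open>f \<in> I\<close> is then divisible, as a monomial, by a minor \<open>M\<^bsub>S,T\<^esub>\<close> of size at least \<open>r\<close>,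
  which belongs to the set \<open>G\<close> of large minors. In the algebra of leading terms, \<open>\<pi>\<close> sends \<open>u\<close> to the
  product of the same factors, so \<open>\<pi>(LT f)\<close> is a multiple of \<open>\<pi>(M\<^bsub>S,T\<^esub>) = \<pi>(LT M\<^bsub>S,T\<^esub>)\<close>. That \<open>G \<subseteq> I\<close>
  is Laplace expansion. For \<open>r = 0\<close> the empty minor \<open>1\<close> lies in \<open>G\<close>, and both ideals of leading terms are
  the whole algebra.

  To prove the fact, substitute for \<open>X\<close> the product \<open>Y Z\<close> of a generic matrix
  with \<open>r - 1\<close> columns and a generic matrix with \<open>r - 1\<close> rows. Minors of size at least \<open>r\<close> vanish, so
  this kills \<open>I\<close> and all standard monomials with a large factor. A smaller minor becomes a polynomial
  whose lexicographically leading term is, with coefficient 1, the product of the variables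
  \<open>Y\<^bsub>S(i),i\<^esub> Z\<^bsub>i,T(i)\<^esub>\<close>, where \<open>S(i)\<close> and \<open>T(i)\<close> are the \<open>i\<close>-th elements (\<open>det_product_monic\<close>). The
  leading exponent of a product of minors thus records, for every \<open>i\<close>, the multiset of \<open>i\<close>-th row
  indices and the multiset of \<open>i\<close>-th column indices of its factors. Since the factors of a standard
  monomial form a chain, they can be read off from these multisets (\<open>leading_exp_inj\<close>). So the images
  of the remaining standard monomials have distinct leading terms and are linearly independent, and
  their coefficients in an element of \<open>I\<close> are zero.

  That the standard bideterminants form a basis of the polynomial ring is part of the existence of
  an algebra of leading terms: \<open>\<pi>\<^sup>-\<^sup>1\<close> carries the standard basis of that algebra back
  (lemma \<open>leading_term_algebra_standard_basis\<close>).
\<close>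

section \<open>Polynomials with a monic leading term\<close>

text \<open>
  The leading coefficient is required to be 1 so that the notion is closed under products over any
  commutative coefficient ring.
\<close>
definition monic_at :: "('e::linorder \<Rightarrow>\<^sub>0 'k::zero_neq_one) \<Rightarrow> 'e \<Rightarrow> bool" where
  "monic_at p e \<longleftrightarrow> Poly_Mapping.lookup p e = 1 \<and> (\<forall>k\<in>Poly_Mapping.keys p. k \<le> e)"

lemma monic_at_single: "monic_at (Poly_Mapping.single e 1) e"
  by (simp add: monic_at_def)

lemma poly_mapping_sum_single: "(\<Sum>e\<in>Poly_Mapping.keys p. Poly_Mapping.single e (Poly_Mapping.lookup p e)) = p"
  by (rule poly_mapping_eqI)
    (auto simp: lookup_sum lookup_single when_def in_keys_iff)

lemma times_eq_sum_single:
  fixes p q :: "'e::comm_monoid_add \<Rightarrow>\<^sub>0 'k::comm_semiring_0"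
  shows "p * q = (\<Sum>e\<in>Poly_Mapping.keys p. \<Sum>e'\<in>Poly_Mapping.keys q.
      Poly_Mapping.single (e + e') (Poly_Mapping.lookup p e * Poly_Mapping.lookup q e'))"
  by (subst (1) poly_mapping_sum_single[of p, symmetric],
      subst (1) poly_mapping_sum_single[of q, symmetric])
    (simp add: sum_product mult_single)

text \<open>
  Since addition of exponents is strictly monotone, only the two leading terms contribute to the
  exponent \<open>a + b\<close> of the product.
\<close>
lemma monic_at_mult:
  fixes p q :: "'e::{linorder,ordered_cancel_comm_monoid_add} \<Rightarrow>\<^sub>0 'k::comm_ring_1"
  assumes p: "monic_at p a" and q: "monic_at q b"
  shows "monic_at (p * q) (a + b)"
proof -
  have key: "e + e' = a + b \<longleftrightarrow> e = a \<and> e' = b"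
    if "e \<in> Poly_Mapping.keys p" "e' \<in> Poly_Mapping.keys q" for e e'
  proof -
    have "e \<le> a" "e' \<le> b"
      using that p q by (auto simp: monic_at_def)
    then show ?thesis
      by (metis add_less_le_mono add_le_less_mono order_le_imp_less_or_eq order_less_irrefl)
  qed
  have in_p: "a \<in> Poly_Mapping.keys p" and in_q: "b \<in> Poly_Mapping.keys q"
    using p q by (auto simp: monic_at_def in_keys_iff)
  have "Poly_Mapping.lookup (p * q) (a + b) =
      (\<Sum>e\<in>Poly_Mapping.keys p. \<Sum>e'\<in>Poly_Mapping.keys q.
        if e = a \<and> e' = b then Poly_Mapping.lookup p e * Poly_Mapping.lookup q e' else 0)"
    unfolding times_eq_sum_single[of p q] lookup_sum lookup_single when_def by (intro sum.cong refl) (simp add: key)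
  also have "\<dots> = (\<Sum>e\<in>Poly_Mapping.keys p. if e = a then
      (\<Sum>e'\<in>Poly_Mapping.keys q.
        if e' = b then Poly_Mapping.lookup p e * Poly_Mapping.lookup q e' else 0) else 0)"
    by (intro sum.cong refl) auto
  also have "\<dots> = 1"
    using in_p in_q p q by (simp add: monic_at_def)
  finally have "Poly_Mapping.lookup (p * q) (a + b) = 1" .
  moreover have "k \<le> a + b" if k: "k \<in> Poly_Mapping.keys (p * q)" for k
  proof -
    obtain e e' where "k = e + e'" "e \<in> Poly_Mapping.keys p" "e' \<in> Poly_Mapping.keys q"
      using keys_mult[of p q] k by blast
    then show ?thesis
      using p q by (auto simp: monic_at_def intro: add_mono)
  qed
  ultimately show ?thesis
    by (simp add: monic_at_def)
qed

lemma monic_at_prod_mset: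
  fixes q :: "'h \<Rightarrow> 'e::{linorder,ordered_cancel_comm_monoid_add} \<Rightarrow>\<^sub>0 'k::comm_ring_1"
  assumes "\<And>x. x \<in># u \<Longrightarrow> monic_at (q x) (d x)"
  shows "monic_at (prod_mset (image_mset q u)) (sum_mset (image_mset d u))"
  using assms
proof (induction u)
  case empty
  show ?case
    using monic_at_single[of 0] by (simp del: single_one flip: single_one)
next
  case (add x u)
  then show ?case
    by (simp add: monic_at_mult)
qed

lemma monic_at_sum_single:
  assumes "finite I" "i \<in> I" "c i = 1" "\<And>j. j \<in> I \<Longrightarrow> j \<noteq> i \<Longrightarrow> E j < E i"
  shows "monic_at (\<Sum>j\<in>I. Poly_Mapping.single (E j) (c j)) (E i)"
proof -
  have "Poly_Mapping.lookup (\<Sum>j\<in>I. Poly_Mapping.single (E j) (c j)) (E i) = (\<Sum>j\<in>I. if j = i then c j else 0)"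
    unfolding lookup_sum lookup_single when_def using less_imp_neq[OF assms(4)] by (intro sum.cong) auto
  also have "\<dots> = 1" using assms by simp
  finally have "Poly_Mapping.lookup (\<Sum>j\<in>I. Poly_Mapping.single (E j) (c j)) (E i) = 1" .
  moreover have "k \<le> E i" if "k \<in> Poly_Mapping.keys (\<Sum>j\<in>I. Poly_Mapping.single (E j) (c j))" for k
  proof -
    have "(\<Sum>j\<in>I. Poly_Mapping.lookup (Poly_Mapping.single (E j) (c j)) k) \<noteq> 0"
      using that by (simp add: in_keys_iff lookup_sum)
    then obtain j where "j \<in> I" "Poly_Mapping.lookup (Poly_Mapping.single (E j) (c j)) k \<noteq> 0"
      by (meson sum.not_neutral_contains_not_neutral)
    then show ?thesis using assms(4)[of j] by (cases "j = i") (auto simp: lookup_single when_def split: if_splits)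
  qed
  ultimately show ?thesis by (simp add: monic_at_def)
qed

text \<open>
  In a vanishing combination, the largest leading exponent among the terms with nonzero coefficient
  cannot cancel, because no other term reaches it.
\<close>
lemma monic_at_independent:
  fixes q :: "'u \<Rightarrow> 'e::{linorder,comm_monoid_add} \<Rightarrow>\<^sub>0 'k::comm_ring_1"
  assumes fin: "finite U" and inj: "inj_on d U"
    and monic: "\<And>u. u \<in> U \<Longrightarrow> monic_at (q u) (d u)"
    and zero: "(\<Sum>u\<in>U. Poly_Mapping.single 0 (c u) * q u) = 0"
  shows "\<forall>u\<in>U. c u = 0"
proof (rule ccontr)
  let ?V = "{u \<in> U. c u \<noteq> 0}"
  assume "\<not> (\<forall>u\<in>U. c u = 0)"
  then have ne: "d ` ?V \<noteq> {}" by auto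
  have finV: "finite (d ` ?V)" using fin by simp
  obtain w where w: "w \<in> ?V" and wmax: "d w = Max (d ` ?V)"
    using Max_in[OF finV ne] by (metis (no_types, lifting) imageE)
  have lw: "Poly_Mapping.lookup (Poly_Mapping.single 0 (c u) * q u) (d w)
      = (if u = w then c w else 0)" if "u \<in> U" for u
  proof -
    have *: "Poly_Mapping.lookup (Poly_Mapping.single 0 (c u) * q u) (d w) = c u * Poly_Mapping.lookup (q u) (d w)"
      by (cases "c u = 0") (simp_all flip: mult_map_scale_conv_mult add: Poly_Mapping.map.rep_eq when_def)
    show ?thesis
    proof (cases "u = w")
      case True
      then show ?thesis using * monic[OF that] by (simp add: monic_at_def)
    next
      case False
      have "Poly_Mapping.lookup (q u) (d w) = 0" if "c u \<noteq> 0"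
      proof -
        have "d u \<le> d w" unfolding wmax using finV that \<open>u \<in> U\<close> by (intro Max_ge) auto
        moreover have "d u \<noteq> d w" using inj False \<open>u \<in> U\<close> w by (auto dest: inj_onD)
        ultimately have "\<not> d w \<le> d u" by auto
        then show ?thesis using monic[OF \<open>u \<in> U\<close>] by (auto simp: monic_at_def in_keys_iff)
      qed
      then show ?thesis using * False by (cases "c u = 0") auto
    qed
  qed
  have "0 = Poly_Mapping.lookup (\<Sum>u\<in>U. Poly_Mapping.single 0 (c u) * q u) (d w)"
    by (simp add: zero)
  also have "\<dots> = (\<Sum>u\<in>U. if u = w then c w else 0)"
    unfolding lookup_sum by (intro sum.cong refl) (rule lw)
  also have "\<dots> = c w" using fin w by simp
  finally show False using w by simp
qed

section \<open>Substitution into polynomials\<close>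

text \<open>
  The homomorphism of \<open>'k\<close>-algebras that sends the variable \<open>v\<close> to \<open>\<psi> v\<close>. With finitely many
  variables the product runs over all of them, which makes it additive in the exponent vector.
\<close>
definition poly_subst ::
  "('v::finite \<Rightarrow> 'e::comm_monoid_add \<Rightarrow>\<^sub>0 'k::comm_ring_1) \<Rightarrow> (('v \<Rightarrow>\<^sub>0 nat) \<Rightarrow>\<^sub>0 'k) \<Rightarrow> ('e \<Rightarrow>\<^sub>0 'k)" where
  "poly_subst \<psi> p = (\<Sum>e\<in>Poly_Mapping.keys p. Poly_Mapping.single 0 (Poly_Mapping.lookup p e) *
     (\<Prod>v\<in>UNIV. \<psi> v ^ Poly_Mapping.lookup e v))"

lemma poly_subst_superset:
  assumes "finite K" "Poly_Mapping.keys p \<subseteq> K"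
  shows "poly_subst \<psi> p = (\<Sum>e\<in>K. Poly_Mapping.single 0 (Poly_Mapping.lookup p e) *
     (\<Prod>v\<in>UNIV. \<psi> v ^ Poly_Mapping.lookup e v))"
  unfolding poly_subst_def using assms by (intro sum.mono_neutral_left) (auto simp: in_keys_iff)

lemma poly_subst_single:
  "poly_subst \<psi> (Poly_Mapping.single e c) = Poly_Mapping.single 0 c * (\<Prod>v\<in>UNIV. \<psi> v ^ Poly_Mapping.lookup e v)"
  by (simp add: poly_subst_def)

lemma poly_subst_add: "poly_subst \<psi> (p + q) = poly_subst \<psi> p + poly_subst \<psi> q"
proof -
  let ?K = "Poly_Mapping.keys p \<union> Poly_Mapping.keys q"
  show ?thesis
    using keys_add[of p q]
    by (simp add: poly_subst_superset[of ?K] lookup_add single_add distrib_right sum.distrib)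
qed

lemma poly_subst_sum: "poly_subst \<psi> (\<Sum>i\<in>I. f i) = (\<Sum>i\<in>I. poly_subst \<psi> (f i))"
  by (induction I rule: infinite_finite_induct) (simp_all add: poly_subst_add poly_subst_def[of _ 0])

lemma poly_subst_mult:
  fixes \<psi> :: "'v::finite \<Rightarrow> 'e::comm_monoid_add \<Rightarrow>\<^sub>0 'k::comm_ring_1"
  shows "poly_subst \<psi> (p * q) = poly_subst \<psi> p * poly_subst \<psi> q"
proof -
  have "Poly_Mapping.single 0 (x * y) = Poly_Mapping.single 0 x * Poly_Mapping.single (0::'e) y" for x y :: 'k
    by (simp add: mult_single)
  then show ?thesis
    unfolding times_eq_sum_single[of p q] poly_subst_sum poly_subst_single
    by (simp add: poly_subst_def sum_product lookup_add power_add prod.distrib mult_ac)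
qed

lemma poly_subst_comm_ring_hom: "comm_ring_hom (poly_subst \<psi>)"
  using poly_subst_single[of \<psi> 0 1]
  by unfold_locales (simp_all add: poly_subst_add poly_subst_mult poly_subst_def[of _ 0])

lemma poly_subst_mat_var: "poly_subst \<psi> (mat_var i j) = \<psi> (i, j)"
proof -
  have "(\<Prod>v\<in>UNIV. \<psi> v ^ Poly_Mapping.lookup (Poly_Mapping.single (i, j) (1::nat)) v)
      = (\<Prod>v\<in>UNIV. if v = (i, j) then \<psi> v else 1)"
    by (intro prod.cong refl) (auto simp: lookup_single when_def)
  then show ?thesis
    by (simp add: mat_var_def poly_subst_single)
qed

lemma poly_subst_scale: "poly_subst \<psi> (poly_scale c p) = Poly_Mapping.single 0 c * poly_subst \<psi> p"
  by (simp add: poly_scale_def poly_subst_mult poly_subst_single)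

section \<open>Determinants of products of generic matrices\<close>

text \<open>
  The Cauchy-Binet formula before its terms are grouped: expand every row multilinearly, drop the
  choices \<open>f\<close> that repeat a row of \<open>B\<close>, and expand the remaining determinants. The leading term can be
  read off from this form. The condition \<open>f a = a\<close> outside of \<open>{0..<p}\<close> only makes \<open>f\<close> unique.
\<close>
lemma det_sum_products:
  fixes A B :: "nat \<Rightarrow> nat \<Rightarrow> 'a::comm_ring_1"
  shows "det (mat p p (\<lambda>(a, b). \<Sum>l<N. A a l * B l b)) =
    (\<Sum>f | (\<forall>a\<in>{0..<p}. f a \<in> {..<N}) \<and> (\<forall>a. a \<notin> {0..<p} \<longrightarrow> f a = a) \<and> inj_on f {0..<p}.
      \<Sum>\<sigma> | \<sigma> permutes {0..<p}. signof \<sigma> * ((\<Prod>a = 0..<p. A a (f a)) * (\<Prod>a = 0..<p. B (f a) (\<sigma> a))))"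
proof -
  let ?F = "{f. (\<forall>a\<in>{0..<p}. f a \<in> {..<N}) \<and> (\<forall>a. a \<notin> {0..<p} \<longrightarrow> f a = a)}"
  let ?B = "\<lambda>l. vec p (\<lambda>b. B l b)"
  have "mat p p (\<lambda>(a, b). \<Sum>l<N. A a l * B l b) =
      mat\<^sub>r p p (\<lambda>a. finsum_vec TYPE('a) p (\<lambda>l. A a l \<cdot>\<^sub>v ?B l) {..<N})"
    by (rule eq_matI) (auto simp: index_finsum_vec)
  then have "det (mat p p (\<lambda>(a, b). \<Sum>l<N. A a l * B l b)) =
      (\<Sum>f\<in>?F. det (mat\<^sub>r p p (\<lambda>a. A a (f a) \<cdot>\<^sub>v ?B (f a))))"
    by (simp only:) (rule det_linear_rows_sum, auto)
  also have "\<dots> = (\<Sum>f\<in>?F. (\<Prod>a = 0..<p. A a (f a)) * det (mat\<^sub>r p p (\<lambda>a. ?B (f a))))"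
    by (intro sum.cong refl det_rows_mul) auto
  also have "\<dots> = (\<Sum>f\<in>{f\<in>?F. inj_on f {0..<p}}. (\<Prod>a = 0..<p. A a (f a)) * det (mat\<^sub>r p p (\<lambda>a. ?B (f a))))"
  proof (rule sum.mono_neutral_right)
    show "finite ?F" by (rule finite_bounded_functions) auto
    show "\<forall>f\<in>?F - {f \<in> ?F. inj_on f {0..<p}}. (\<Prod>a = 0..<p. A a (f a)) * det (mat\<^sub>r p p (\<lambda>a. ?B (f a))) = 0"
    proof
      fix f assume "f \<in> ?F - {f \<in> ?F. inj_on f {0..<p}}"
      then obtain i j where ij: "i < p" "j < p" "i \<noteq> j" "f i = f j"
        by (auto simp: inj_on_def)
      have "det (mat\<^sub>r p p (\<lambda>a. ?B (f a))) = 0"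
        by (rule det_identical_rows[of _ p i j]) (use ij in auto)
      then show "(\<Prod>a = 0..<p. A a (f a)) * det (mat\<^sub>r p p (\<lambda>a. ?B (f a))) = 0" by simp
    qed
  qed auto
  also have "\<dots> = (\<Sum>f | (\<forall>a\<in>{0..<p}. f a \<in> {..<N}) \<and> (\<forall>a. a \<notin> {0..<p} \<longrightarrow> f a = a) \<and> inj_on f {0..<p}.
      \<Sum>\<sigma> | \<sigma> permutes {0..<p}. signof \<sigma> * ((\<Prod>a = 0..<p. A a (f a)) * (\<Prod>a = 0..<p. B (f a) (\<sigma> a))))"
  proof (rule sum.cong, force)
    fix f :: "nat \<Rightarrow> nat"
    have "det (mat\<^sub>r p p (\<lambda>a. ?B (f a))) =
        (\<Sum>\<sigma> | \<sigma> permutes {0..<p}. signof \<sigma> * (\<Prod>a = 0..<p. B (f a) (\<sigma> a)))"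
    proof (subst det_def'[of _ p], simp, intro sum.cong refl arg_cong2[of _ _ _ _ "(*)"] prod.cong)
      fix \<sigma> a assume "\<sigma> \<in> {\<sigma>. \<sigma> permutes {0..<p}}" "a \<in> {0..<p}"
      then show "mat\<^sub>r p p (\<lambda>a. ?B (f a)) $$ (a, \<sigma> a) = B (f a) (\<sigma> a)"
        using permutes_in_image[of \<sigma> "{0..<p}" a] by auto
    qed
    then show "(\<Prod>a = 0..<p. A a (f a)) * det (mat\<^sub>r p p (\<lambda>a. ?B (f a))) =
      (\<Sum>\<sigma> | \<sigma> permutes {0..<p}. signof \<sigma> * ((\<Prod>a = 0..<p. A a (f a)) * (\<Prod>a = 0..<p. B (f a) (\<sigma> a))))"
      by (simp add: sum_distrib_left mult_ac)
  qed
  finally show ?thesis .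
qed

text \<open>
  The variables of the target ring are triples: \<open>(0, l, i)\<close> is the entry in row \<open>i\<close> and column \<open>l\<close> of the
  left factor, \<open>(1, l, j)\<close> the entry in row \<open>l\<close> and column \<open>j\<close> of the right factor. The exponent below
  belongs to the monomial that uses, for every \<open>b < p\<close>, the index \<open>v b\<close> at position \<open>h b\<close>.
\<close>
definition position_exp :: "nat \<Rightarrow> (nat \<Rightarrow> nat) \<Rightarrow> (nat \<Rightarrow> nat) \<Rightarrow> nat \<Rightarrow> (nat \<times> nat \<times> nat) \<Rightarrow>\<^sub>0 nat" where
  "position_exp c h v p = (\<Sum>b<p. Poly_Mapping.single (c, h b, v b) 1)"

lemma lookup_position_exp:
  "Poly_Mapping.lookup (position_exp c h v p) (c', l, j) = card {b. b < p \<and> c = c' \<and> h b = l \<and> v b = j}"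
proof -
  have "Poly_Mapping.lookup (position_exp c h v p) (c', l, j) =
      (\<Sum>b<p. if c = c' \<and> h b = l \<and> v b = j then 1 else 0)"
    unfolding position_exp_def lookup_sum lookup_single when_def by (intro sum.cong) auto
  then show ?thesis
    by (simp add: sum.If_cases Int_def conj_commute conj_left_commute)
qed

text \<open>
  Exponents are compared lexicographically, where the least variable counts most and variables with
  a small position come first. The larger monomial is therefore the one that puts the smallest
  indices into the first positions; an injective \<open>h\<close> can use every position only once, so putting
  the increasing sequence \<open>v\<close> in its own order is best. The proof compares at the first position
  \<open>a\<close> that \<open>h\<close> does not fix: there \<open>h\<close> can only place an index larger than \<open>v a\<close>.
\<close>
lemma position_exp_less_diagonal:
  assumes h: "inj_on h {..<p}" and v: "strict_mono_on {..<p} v" and ne: "\<not> (\<forall>b<p. h b = b)"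
  shows "position_exp c h v p < position_exp c (\<lambda>b. b) v p"
proof -
  define a where "a = (LEAST b. b < p \<and> h b \<noteq> b)"
  have a: "a < p" "h a \<noteq> a" using LeastI_ex[of "\<lambda>b. b < p \<and> h b \<noteq> b"] ne by (auto simp: a_def)
  have below: "h b = b" if "b < a" for b
    using not_less_Least[of b "\<lambda>b. b < p \<and> h b \<noteq> b"] that a(1) by (auto simp: a_def)
  have fixed: "b = l" if "b < p" "h b = l" "l < a" for b l
    using below[OF that(3)] that a(1) h by (metis inj_onD lessThan_iff less_trans)
  have above: "a < b" if "b < p" "h b = a" for b
    using below[of b] that a by (metis linorder_neqE_nat)
  have v': "v a < v b" if "a < b" "b < p" for b
    using v that by (auto simp: strict_mono_on_def)
  \<comment> \<open>Before the variable \<open>(c, a, v a)\<close> both exponents agree; at it, only the diagonal one is positive.\<close>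
  have eq: "{b. b < p \<and> h b = l \<and> v b = j} = {b. b < p \<and> b = l \<and> v b = j}"
    if "l < a \<or> l = a \<and> j < v a" for l j
  proof (cases "l < a")
    case True
    then show ?thesis using fixed below by auto
  next
    case False
    with that have "l = a" "j < v a" by auto
    then show ?thesis using above v' by fastforce
  qed
  have at: "{b. b < p \<and> h b = a \<and> v b = v a} = {}" "{b. b < p \<and> b = a \<and> v b = v a} = {a}"
    using above v' a by fastforce+
  show ?thesis
    unfolding less_poly_mapping.rep_eq less_fun_def
  proof (intro exI[of _ "(c, a, v a)"] conjI allI impI)
    show "Poly_Mapping.lookup (position_exp c h v p) (c, a, v a)
        < Poly_Mapping.lookup (position_exp c (\<lambda>b. b) v p) (c, a, v a)"
      by (simp add: lookup_position_exp at)
    fix k assume k: "k < (c, a, v a)"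
    obtain c' l j where "k = (c', l, j)" by (cases k)
    then have "c \<noteq> c' \<or> l < a \<or> l = a \<and> j < v a" using k by auto
    then have "{b. b < p \<and> c = c' \<and> h b = l \<and> v b = j} = {b. b < p \<and> c = c' \<and> b = l \<and> v b = j}"
      using eq[of l j] by blast
    then show "Poly_Mapping.lookup (position_exp c h v p) k
        = Poly_Mapping.lookup (position_exp c (\<lambda>b. b) v p) k"
      by (simp only: \<open>k = (c', l, j)\<close> lookup_position_exp)
  qed
qed

text \<open>The entry in row \<open>i\<close> and column \<open>j\<close> of the product of two generic matrices of inner dimension \<open>N\<close>.\<close>
definition product_entry :: "nat \<Rightarrow> nat \<Rightarrow> nat \<Rightarrow> ((nat \<times> nat \<times> nat) \<Rightarrow>\<^sub>0 nat) \<Rightarrow>\<^sub>0 'k::comm_ring_1" where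
  "product_entry N i j = (\<Sum>l<N. Poly_Mapping.single (Poly_Mapping.single (0, l, i) 1) 1 *
      Poly_Mapping.single (Poly_Mapping.single (1, l, j) 1) 1)"

lemma prod_single_one:
  "(\<Prod>a\<in>I. Poly_Mapping.single (E a) 1) = Poly_Mapping.single (\<Sum>a\<in>I. E a) (1 :: 'k::comm_ring_1)"
  by (induction I rule: infinite_finite_induct) (simp_all add: mult_single)

text \<open>There is no injection of \<open>p\<close> rows into \<open>N\<close> positions, so the expansion is empty.\<close>
lemma det_product_zero:
  assumes "N < p"
  shows "det (mat p p (\<lambda>(a, b). product_entry N (s a) (t b))) = 0"
proof -
  have "\<not> inj_on f {0..<p}" if "\<forall>a\<in>{0..<p}. f a \<in> {..<N}" for f :: "nat \<Rightarrow> nat"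
    using that assms card_inj_on_le[of f "{0..<p}" "{..<N}"] by auto
  then have empty: "{f. (\<forall>a\<in>{0..<p}. f a \<in> {..<N}) \<and> (\<forall>a. a \<notin> {0..<p} \<longrightarrow> f a = a) \<and> inj_on f {0..<p}} = {}"
    by blast
  show ?thesis
    unfolding product_entry_def det_sum_products empty by simp
qed

text \<open>
  By \<open>position_exp_less_diagonal\<close>, applied to the row factors and to the column factors, the summand
  of the expansion with \<open>f = id\<close> and \<open>\<sigma> = id\<close> strictly dominates all others.
\<close>
lemma det_product_monic:
  assumes p: "p \<le> N" and s: "strict_mono_on {..<p} s" and t: "strict_mono_on {..<p} t"
  shows "monic_at (det (mat p p (\<lambda>(a, b). product_entry N (s a) (t b))) :: _ \<Rightarrow>\<^sub>0 'k::comm_ring_1)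
    (position_exp 0 (\<lambda>a. a) s p + position_exp 1 (\<lambda>a. a) t p)"
proof -
  let ?F = "{f. (\<forall>a\<in>{0..<p}. f a \<in> {..<N}) \<and> (\<forall>a. a \<notin> {0..<p} \<longrightarrow> f a = a) \<and> inj_on f {0..<p}}"
  let ?P = "{\<sigma>. \<sigma> permutes {0..<p}}"
  \<comment> \<open>Reindexing the column factors by \<open>\<sigma>\<close> turns them into a placement of the sorted columns.\<close>
  define E where "E = (\<lambda>(f, \<sigma>). position_exp 0 f s p + position_exp 1 (f \<circ> Hilbert_Choice.inv \<sigma>) t p)"
  let ?c = "\<lambda>(f, \<sigma>). of_int (sign \<sigma>) :: 'k"
  have "finite {f. (\<forall>a\<in>{0..<p}. f a \<in> {..<N}) \<and> (\<forall>a. a \<notin> {0..<p} \<longrightarrow> f a = a)}"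
    by (rule finite_bounded_functions) auto
  then have finF: "finite ?F"
    by (rule rev_finite_subset) auto
  have expand: "det (mat p p (\<lambda>(a, b). product_entry N (s a) (t b))) =
      (\<Sum>(f, \<sigma>)\<in>?F \<times> ?P. Poly_Mapping.single (E (f, \<sigma>)) (of_int (sign \<sigma>) :: 'k))"
    unfolding product_entry_def det_sum_products sum.cartesian_product[symmetric]
  proof (intro sum.cong refl)
    fix f \<sigma> assume "f \<in> ?F" "\<sigma> \<in> ?P"
    then have \<sigma>: "\<sigma> permutes {0..<p}" by simp
    have "(\<Sum>a = 0..<p. Poly_Mapping.single (1, f a, t (\<sigma> a)) 1) = position_exp 1 (f \<circ> Hilbert_Choice.inv \<sigma>) t p"
      unfolding position_exp_def atLeast0LessThan[symmetric]
      by (subst sum.permute[OF \<sigma>]) (simp add: o_def permutes_inverses[OF \<sigma>])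
    moreover have "(\<Sum>a = 0..<p. Poly_Mapping.single (0, f a, s a) 1) = position_exp 0 f s p"
      by (simp add: position_exp_def atLeast0LessThan)
    moreover have "of_int (sign \<sigma>) = Poly_Mapping.single (0 :: (nat \<times> nat \<times> nat) \<Rightarrow>\<^sub>0 nat) (of_int (sign \<sigma>) :: 'k)"
      by simp
    ultimately show "signof \<sigma> * ((\<Prod>a = 0..<p. Poly_Mapping.single (Poly_Mapping.single (0, f a, s a) 1) 1) *
        (\<Prod>a = 0..<p. Poly_Mapping.single (Poly_Mapping.single (1, f a, t (\<sigma> a)) 1) 1)) =
        Poly_Mapping.single (E (f, \<sigma>)) (of_int (sign \<sigma>) :: 'k)"
      by (simp only: prod_single_one mult_single E_def prod.case) simp
  qed
  have less: "E x < E (id, id)" if x: "x \<in> ?F \<times> ?P" "x \<noteq> (id, id)" for x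
  proof -
    obtain f \<sigma> where [simp]: "x = (f, \<sigma>)" by (cases x)
    have f: "inj_on f {..<p}" "\<And>a. p \<le> a \<Longrightarrow> f a = a" and \<sigma>: "\<sigma> permutes {0..<p}"
      using x by (auto simp: atLeast0LessThan)
    have inv: "Hilbert_Choice.inv \<sigma> permutes {..<p}" using permutes_inv[OF \<sigma>] by (simp add: atLeast0LessThan)
    have g: "inj_on (f \<circ> Hilbert_Choice.inv \<sigma>) {..<p}"
      using f(1) by (intro comp_inj_on) (simp_all add: permutes_image[OF inv] permutes_inj_on[OF inv])
    have le1: "position_exp 0 f s p \<le> position_exp 0 (\<lambda>a. a) s p"
    proof (cases "\<forall>b<p. f b = b")
      case False
      then show ?thesis using position_exp_less_diagonal[OF f(1) s] by (simp add: less_imp_le)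
    qed (simp add: position_exp_def)
    have le2: "position_exp 1 (f \<circ> Hilbert_Choice.inv \<sigma>) t p \<le> position_exp 1 (\<lambda>a. a) t p"
    proof (cases "\<forall>b<p. (f \<circ> Hilbert_Choice.inv \<sigma>) b = b")
      case False
      then show ?thesis using position_exp_less_diagonal[OF g t] by (simp add: less_imp_le)
    qed (simp add: position_exp_def)
    show ?thesis
    proof (cases "\<forall>b<p. f b = b")
      case True
      then have "f = id" using f(2) by (metis eq_id_iff leI)
      then have "Hilbert_Choice.inv \<sigma> \<noteq> id" using x(2) \<sigma> by (metis \<open>x = (f, \<sigma>)\<close> inv_id permutes_inv_inv)
      then have "\<not> (\<forall>b<p. (f \<circ> Hilbert_Choice.inv \<sigma>) b = b)"
        using inv \<open>f = id\<close> by (auto simp: permutes_def fun_eq_iff)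
      from position_exp_less_diagonal[OF g t this] le1 show ?thesis
        by (simp add: E_def id_def o_def add_le_less_mono)
    next
      case False
      from position_exp_less_diagonal[OF f(1) s this] le2 show ?thesis
        by (simp add: E_def id_def o_def add_less_le_mono)
    qed
  qed
  have "monic_at (\<Sum>x\<in>?F \<times> ?P. Poly_Mapping.single (E x) (?c x)) (E (id, id))"
  proof (rule monic_at_sum_single)
    show "finite (?F \<times> ?P)" using finF finite_permutations[of "{0..<p}"] by auto
    show "(id, id) \<in> ?F \<times> ?P" using p by (auto simp: permutes_id)
  qed (use less in auto)
  moreover have "E (id, id) = position_exp 0 (\<lambda>a. a) s p + position_exp 1 (\<lambda>a. a) t p"
    unfolding E_def prod.case inv_id position_exp_def by simp
  ultimately show ?thesis
    unfolding expand by (simp add: case_prod_unfold)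
qed

section \<open>Minors under the low-rank substitution\<close>

text \<open>
  Row and column indices are turned into numbers, so that both kinds of variables live in one
  linearly ordered type.
\<close>
definition rank :: "'a::{finite,linorder} \<Rightarrow> nat" where
  "rank i = card {..<i}"

lemma rank_strict_mono: "strict_mono rank"
  by (auto simp: strict_mono_def rank_def intro!: psubset_card_mono)

text \<open>The substitution of the product of generic matrices of inner dimension \<open>N\<close> for \<open>X\<close>.\<close>
definition low_rank_subst ::
  "nat \<Rightarrow> ('m::{finite,linorder}, 'n::{finite,linorder}, 'k::field) matrix_poly \<Rightarrow> ((nat \<times> nat \<times> nat) \<Rightarrow>\<^sub>0 nat) \<Rightarrow>\<^sub>0 'k" where
  "low_rank_subst N = poly_subst (\<lambda>(i, j). product_entry N (rank i) (rank j))"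

text \<open>
  The leading exponent of the image of a square minor of size at most \<open>N\<close>, by
  \<open>low_rank_subst_minor_monic\<close> below.
\<close>
definition diagonal_exp ::
  "'m::{finite,linorder} set \<times> 'n::{finite,linorder} set \<Rightarrow> (nat \<times> nat \<times> nat) \<Rightarrow>\<^sub>0 nat" where
  "diagonal_exp = (\<lambda>(S, T).
     position_exp 0 (\<lambda>a. a) (\<lambda>a. rank (sorted_list_of_set S ! a)) (card S) +
     position_exp 1 (\<lambda>a. a) (\<lambda>a. rank (sorted_list_of_set T ! a)) (card T))"

interpretation low_rank_subst: comm_ring_hom "low_rank_subst N"
  unfolding low_rank_subst_def by (rule poly_subst_comm_ring_hom)

lemma low_rank_subst_minor:
  assumes "card S = card T"
  shows "low_rank_subst N (minor S T) = det (mat (card S) (card S) (\<lambda>(a, b).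
    product_entry N (rank (sorted_list_of_set S ! a)) (rank (sorted_list_of_set T ! b))))"
  unfolding minor_def low_rank_subst.hom_det[symmetric]
  by (rule arg_cong[of _ _ det], rule eq_matI) (auto simp: assms low_rank_subst_def poly_subst_mat_var)

lemma low_rank_subst_minor_zero:
  assumes "card S = card T" "N < card S"
  shows "low_rank_subst N (minor S T) = 0"
  using assms by (simp add: low_rank_subst_minor det_product_zero)

lemma sorted_list_of_set_strict_mono:
  fixes U :: "'a::{finite,linorder} set"
  shows "strict_mono_on {..<card U} (\<lambda>a. sorted_list_of_set U ! a)"
  using strict_sorted_list_of_set[of U] by (auto simp: strict_mono_on_def sorted_wrt_iff_nth_less)

lemma rank_sorted_list_of_set_strict_mono:
  fixes S :: "'a::{finite,linorder} set"
  shows "strict_mono_on {..<card S} (\<lambda>a. rank (sorted_list_of_set S ! a))"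
  using sorted_list_of_set_strict_mono[of S] rank_strict_mono
  by (auto simp: strict_mono_on_def strict_mono_def)

lemma low_rank_subst_minor_monic:
  assumes "card S = card T" "card S \<le> N"
  shows "monic_at (low_rank_subst N (minor S T)) (diagonal_exp (S, T))"
proof -
  have "strict_mono_on {..<card S} (\<lambda>a. rank (sorted_list_of_set T ! a))"
    using rank_sorted_list_of_set_strict_mono[of T] assms(1) by simp
  from det_product_monic[OF assms(2) rank_sorted_list_of_set_strict_mono[of S] this] show ?thesis
    by (simp add: low_rank_subst_minor assms(1) diagonal_exp_def)
qed

section \<open>Standard monomials are determined by their leading exponents\<close>

lemma bd_le_refl: "bd_le x x"
  by (auto simp: bd_le_def split: prod.splits)

lemma bd_le_trans:
  assumes "bd_le x y" "bd_le y z"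
  shows "bd_le x z"
proof -
  obtain S T S' T' U V where xyz: "x = (S, T)" "y = (S', T')" "z = (U, V)"
    by (cases x, cases y, cases z)
  show ?thesis
    using assms unfolding xyz bd_le_def prod.case by (meson order_less_le_trans order_trans)
qed

lemma sorted_list_of_set_nth_inject:
  fixes S S' :: "'a::{finite,linorder} set"
  assumes "card S = card S'"
    and "\<And>i. i < card S \<Longrightarrow> sorted_list_of_set S ! i = sorted_list_of_set S' ! i"
  shows "S = S'"
proof -
  have "sorted_list_of_set S = sorted_list_of_set S'"
    using assms by (intro nth_equalityI) auto
  then show ?thesis by (metis finite set_sorted_list_of_set)
qed

lemma bd_le_antisym:
  assumes "x \<in> bd_H" "y \<in> bd_H" "bd_le x y" "bd_le y x"
  shows "x = y"
proof -
  obtain S T S' T' where xy: "x = (S, T)" "y = (S', T')" by (cases x, cases y)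
  have "card S = card S'" "card T = card S" "card T' = card S'"
    using assms by (auto simp: xy bd_le_def bd_H_def)
  then show ?thesis
    using assms(3,4) unfolding xy bd_le_def
    by (simp add: sorted_list_of_set_nth_inject order.antisym)
qed

lemma standard_iff:
  "u \<in> standard bd_H bd_Sigma \<longleftrightarrow> set_mset u \<subseteq> bd_H \<and> (\<forall>x\<in>#u. \<forall>y\<in>#u. bd_le x y \<or> bd_le y x)"
  by (auto simp: standard_def bd_Sigma_def monomials_def)

lemma standard_factor_square:
  assumes "u \<in> standard bd_H bd_Sigma" "(S, T) \<in># u"
  shows "card S = card T"
proof -
  have "(S, T) \<in> bd_H" using assms unfolding standard_iff by blast
  then show ?thesis by (simp add: bd_H_def)
qed

text \<open>
  The factors of a standard monomial form a chain. Its least element is what the leading exponent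
  reveals first.
\<close>
lemma standard_least:
  assumes "u \<in> standard bd_H bd_Sigma" "u \<noteq> {#}"
  shows "\<exists>x\<in>#u. \<forall>y\<in>#u. bd_le x y"
  using assms
proof (induction u)
  case (add x u)
  show ?case
  proof (cases "u = {#}")
    case True
    then show ?thesis by (simp add: bd_le_refl)
  next
    case False
    moreover have "u \<in> standard bd_H bd_Sigma" using add.prems(1) by (simp add: standard_iff)
    ultimately obtain m where m: "m \<in># u" "\<forall>y\<in>#u. bd_le m y" using add.IH by blast
    have "bd_le x m \<or> bd_le m x" using m add.prems by (simp add: standard_iff)
    then show ?thesis using m by (auto intro: bd_le_refl bd_le_trans)
  qed
qed simp

text \<open>The leading exponent of the image of a product of square minors of size at most \<open>N\<close>.\<close>
definition leading_exp ::
  "('m::{finite,linorder} set \<times> 'n::{finite,linorder} set) multiset \<Rightarrow> (nat \<times> nat \<times> nat) \<Rightarrow>\<^sub>0 nat" where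
  "leading_exp u = sum_mset (image_mset diagonal_exp u)"

lemma lookup_leading_exp_pos:
  "0 < Poly_Mapping.lookup (leading_exp u) k \<longleftrightarrow> (\<exists>x\<in>#u. 0 < Poly_Mapping.lookup (diagonal_exp x) k)"
  unfolding leading_exp_def by (induction u) (auto simp: lookup_add)

lemma lookup_diagonal_exp_pos:
  "0 < Poly_Mapping.lookup (diagonal_exp (S, T)) (0, i, j) \<longleftrightarrow> i < card S \<and> rank (sorted_list_of_set S ! i) = j"
  "0 < Poly_Mapping.lookup (diagonal_exp (S, T)) (1, i, j) \<longleftrightarrow> i < card T \<and> rank (sorted_list_of_set T ! i) = j"
  by (auto simp: diagonal_exp_def lookup_add lookup_position_exp card_gt_0_iff)

text \<open>
  Every entry of \<open>y\<close> leaves a trace in the exponent of \<open>v\<close>, so some factor of \<open>u\<close> has the same entry at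
  the same position; the least factor \<open>x\<close> of \<open>u\<close> is at least as long and has an entry there that is
  at most as large.
\<close>
lemma least_factor_le:
  assumes u: "set_mset u \<subseteq> bd_H" and v: "set_mset v \<subseteq> bd_H"
    and eq: "leading_exp u = leading_exp v"
    and x: "\<forall>z\<in>#u. bd_le x z" and y: "y \<in># v"
  shows "bd_le x y"
proof -
  obtain S T S' T' where xy: "x = (S, T)" "y = (S', T')" by (cases x, cases y)
  have cy: "card T' = card S'" "1 \<le> card S'" using y v by (auto simp: xy bd_H_def)
  have row: "i < card S \<and> sorted_list_of_set S ! i \<le> sorted_list_of_set S' ! i" if i: "i < card S'" for i
  proof -
    have "0 < Poly_Mapping.lookup (leading_exp u) (0, i, rank (sorted_list_of_set S' ! i))"
      unfolding eq lookup_leading_exp_pos using y i lookup_diagonal_exp_pos(1)[of S' T'] unfolding xy by metis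
    then obtain A B where z: "(A, B) \<in># u" "i < card A" "rank (sorted_list_of_set A ! i) = rank (sorted_list_of_set S' ! i)"
      unfolding lookup_leading_exp_pos by (auto simp: lookup_diagonal_exp_pos)
    have "sorted_list_of_set A ! i = sorted_list_of_set S' ! i"
      using z(3) by (simp only: strict_mono_eq[OF rank_strict_mono])
    moreover have "bd_le x (A, B)" using x z(1) by blast
    ultimately show ?thesis using z(2) by (auto simp: xy bd_le_def)
  qed
  have col: "sorted_list_of_set T ! i \<le> sorted_list_of_set T' ! i" if i: "i < card S'" for i
  proof -
    have "0 < Poly_Mapping.lookup (leading_exp u) (1, i, rank (sorted_list_of_set T' ! i))"
      unfolding eq lookup_leading_exp_pos using y i cy(1) lookup_diagonal_exp_pos(2)[of S' T'] unfolding xy by metis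
    then obtain A B where z: "(A, B) \<in># u" "i < card B" "rank (sorted_list_of_set B ! i) = rank (sorted_list_of_set T' ! i)"
      unfolding lookup_leading_exp_pos by (auto simp del: One_nat_def simp: lookup_diagonal_exp_pos)
    moreover have "card B = card A" using z(1) u by (auto simp: bd_H_def)
    moreover have "sorted_list_of_set B ! i = sorted_list_of_set T' ! i"
      using z(3) by (simp only: strict_mono_eq[OF rank_strict_mono])
    moreover have "bd_le x (A, B)" using x z(1) by blast
    ultimately show ?thesis by (auto simp: xy bd_le_def)
  qed
  have "card S' \<le> card S" using row[of "card S' - 1"] cy(2) by linarith
  then show ?thesis using row col by (simp add: xy bd_le_def)
qed

lemma leading_exp_eq_empty:
  assumes "set_mset v \<subseteq> bd_H" "leading_exp v = 0"
  shows "v = {#}"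
proof (rule ccontr)
  assume "v \<noteq> {#}"
  then obtain S T where v: "(S, T) \<in># v" by (metis multiset_nonemptyE surj_pair)
  then have "0 < card S" using assms(1) by (auto simp: bd_H_def)
  then have "0 < Poly_Mapping.lookup (leading_exp v) (0, 0, rank (sorted_list_of_set S ! 0))"
    unfolding lookup_leading_exp_pos using v lookup_diagonal_exp_pos(1)[of S T] by blast
  then show False using assms(2) by simp
qed

text \<open>
  By \<open>least_factor_le\<close>, used in both directions, two standard monomials with the same leading exponent
  have the same least factor. It can be cancelled.
\<close>
lemma leading_exp_inj: "inj_on leading_exp (standard bd_H bd_Sigma)"
proof (rule inj_onI)
  fix u v :: "('m::{finite,linorder} set \<times> 'n::{finite,linorder} set) multiset"
  assume "u \<in> standard bd_H bd_Sigma" "v \<in> standard bd_H bd_Sigma" "leading_exp u = leading_exp v"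
  then show "u = v"
  proof (induction u arbitrary: v rule: measure_induct_rule[of size])
    case (less u)
    have uH: "set_mset u \<subseteq> bd_H" and vH: "set_mset v \<subseteq> bd_H"
      using less.prems by (auto simp: standard_iff)
    show ?case
    proof (cases "u = {#} \<or> v = {#}")
      case True
      then show ?thesis
        using leading_exp_eq_empty[OF uH] leading_exp_eq_empty[OF vH] less.prems(3)
        by (auto simp: leading_exp_def)
    next
      case False
      then obtain x y where x: "x \<in># u" "\<forall>z\<in>#u. bd_le x z" and y: "y \<in># v" "\<forall>z\<in>#v. bd_le y z"
        using standard_least less.prems(1,2) by metis
      have "bd_le x y" "bd_le y x"
        using least_factor_le[OF uH vH less.prems(3) x(2) y(1)]
          least_factor_le[OF vH uH less.prems(3)[symmetric] y(2) x(1)] by auto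
      then have "x = y" using x(1) y(1) uH vH by (intro bd_le_antisym) auto
      obtain u' v' where uv: "u = add_mset x u'" "v = add_mset x v'"
        using x(1) y(1) \<open>x = y\<close> by (metis multi_member_split)
      have "u' = v'"
      proof (rule less.IH)
        show "size u' < size u" by (simp add: uv)
        show "u' \<in> standard bd_H bd_Sigma" "v' \<in> standard bd_H bd_Sigma"
          using less.prems by (auto simp: uv standard_iff)
        show "leading_exp u' = leading_exp v'"
          using less.prems(3) by (simp add: uv leading_exp_def)
      qed
      then show ?thesis by (simp add: uv)
    qed
  qed
qed

section \<open>Large minors lie in the ideal of smaller ones\<close>

interpretation ring_module: Modules.module "(*) :: 'a::comm_ring_1 \<Rightarrow> 'a \<Rightarrow> 'a"
  by unfold_locales (simp_all add: algebra_simps)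

lemma sorted_list_of_set_strict_mono_image:
  fixes s :: "nat \<Rightarrow> 'a::{finite,linorder}"
  assumes "strict_mono_on {..<p} s"
  shows "sorted_list_of_set (s ` {..<p}) = map s [0..<p]" and "card (s ` {..<p}) = p"
proof -
  have "sorted_wrt (<) (map s [0..<p])"
    using assms by (auto simp: sorted_wrt_iff_nth_less strict_mono_on_def)
  moreover have "set (map s [0..<p]) = s ` {..<p}"
    by (simp add: atLeast0LessThan)
  ultimately show "sorted_list_of_set (s ` {..<p}) = map s [0..<p]"
    by (metis finite strict_sorted_equal strict_sorted_list_of_set set_sorted_list_of_set)
  show "card (s ` {..<p}) = p"
    using strict_mono_on_imp_inj_on[OF assms] by (simp add: card_image)
qed

text \<open>
  Laplace expansion along the first row, stated for increasing sequences of indices instead of sets,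
  because deleting a row or a column then only reindexes the sequences.
\<close>
lemma det_mat_var_in_minor_ideal:
  fixes s :: "nat \<Rightarrow> 'm::{finite,linorder}" and t :: "nat \<Rightarrow> 'n::{finite,linorder}"
  assumes "r \<le> p" "strict_mono_on {..<p} s" "strict_mono_on {..<p} t"
  shows "det (mat p p (\<lambda>(a, b). mat_var (s a) (t b))) \<in> (minor_ideal r :: ('m, 'n, 'k::field) matrix_poly set)"
  using assms
proof (induction p arbitrary: s t rule: dec_induct)
  case base
  have "minor (s ` {..<r}) (t ` {..<r}) = det (mat r r (\<lambda>(a, b). mat_var (s a) (t b) :: ('m, 'n, 'k) matrix_poly))"
    unfolding minor_def using base
    by (intro arg_cong[of _ _ det] eq_matI) (simp_all add: sorted_list_of_set_strict_mono_image base)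
  then show ?case
    unfolding minor_ideal_def ideal_span_def
    by (intro ring_module.span_base CollectI exI[of _ "s ` {..<r}"] exI[of _ "t ` {..<r}"])
      (simp add: sorted_list_of_set_strict_mono_image base)
next
  case (step p)
  let ?A = "mat (Suc p) (Suc p) (\<lambda>(a, b). mat_var (s a) (t b) :: ('m, 'n, 'k) matrix_poly)"
  have "?A $$ (0, j) * cofactor ?A 0 j \<in> minor_ideal r" if "j < Suc p" for j
  proof -
    let ?t = "\<lambda>b. t (if b < j then b else Suc b)"
    have "mat_delete ?A 0 j = mat p p (\<lambda>(a, b). mat_var (s (Suc a)) (?t b))"
      by (rule eq_matI) (auto simp: mat_delete_def)
    moreover have "strict_mono_on {..<p} (\<lambda>a. s (Suc a))" "strict_mono_on {..<p} ?t"
      using step.prems by (auto simp: strict_mono_on_def)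
    ultimately have "det (mat_delete ?A 0 j) \<in> minor_ideal r"
      using step.IH by simp
    then show ?thesis
      unfolding cofactor_def minor_ideal_def ideal_span_def
      by (intro ring_module.span_scale)
  qed
  then have "(\<Sum>j<Suc p. ?A $$ (0, j) * cofactor ?A 0 j) \<in> minor_ideal r"
    unfolding minor_ideal_def ideal_span_def by (intro ring_module.span_sum) auto
  moreover have "det ?A = (\<Sum>j<Suc p. ?A $$ (0, j) * cofactor ?A 0 j)"
    by (rule laplace_expansion_row) auto
  ultimately show ?case by simp
qed

lemma minor_in_minor_ideal:
  assumes "card S = card T" "r \<le> card S"
  shows "minor S T \<in> minor_ideal r"
  using det_mat_var_in_minor_ideal[OF assms(2) sorted_list_of_set_strict_mono[of S], of "\<lambda>a. sorted_list_of_set T ! a"]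
    sorted_list_of_set_strict_mono[of T] assms(1)
  by (simp add: minor_def)

section \<open>Leading terms with respect to a basis of standard monomials\<close>

text \<open>
  The inverse of \<open>\<pi>\<close> is a linear bijection that maps the basis of standard monomials of the algebra
  of leading terms to the standard monomials of the original algebra.
\<close>
lemma leading_term_algebra_standard_basis:
  assumes "leading_term_algebra scale H g \<Sigma> ord scale_lt g_lt \<pi>"
  shows "inj_on (mon_eval g) (standard H \<Sigma>)"
    and "\<not> Modules.module.dependent scale (mon_eval g ` standard H \<Sigma>)"
    and "Modules.module.span scale (mon_eval g ` standard H \<Sigma>) = UNIV"
proof -
  have lin: "Vector_Spaces.linear scale scale_lt \<pi>" and bij: "bij \<pi>"
    and \<pi>: "\<And>u. u \<in> standard H \<Sigma> \<Longrightarrow> \<pi> (mon_eval g u) = mon_eval g_lt u"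
    and ASL: "pseudo_ASL scale_lt H g_lt \<Sigma>"
    using assms unfolding leading_term_algebra_def by auto
  have inj_lt: "inj_on (mon_eval g_lt) (standard H \<Sigma>)"
    and indep_lt: "\<not> Modules.module.dependent scale_lt (mon_eval g_lt ` standard H \<Sigma>)"
    and span_lt: "Modules.module.span scale_lt (mon_eval g_lt ` standard H \<Sigma>) = UNIV"
    using ASL by (auto simp: pseudo_ASL_def)
  let ?inv = "Hilbert_Choice.inv \<pi>"
  interpret \<pi>: Vector_Spaces.linear scale scale_lt \<pi> by (fact lin)
  have inv_hom: "Modules.module_hom scale_lt scale ?inv"
    by (rule Modules.module_pair.bij_module_hom_imp_inv_module_hom[OF _ \<pi>.module_hom_axioms bij]) unfold_locales
  have "?inv (mon_eval g_lt u) = mon_eval g u" if "u \<in> standard H \<Sigma>" for u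
    using \<pi>[OF that] bij by (metis bij_is_inj inv_f_f)
  then have image: "?inv ` mon_eval g_lt ` standard H \<Sigma> = mon_eval g ` standard H \<Sigma>"
    by (simp add: image_image)
  show "inj_on (mon_eval g) (standard H \<Sigma>)"
    using inj_lt \<pi> unfolding inj_on_def by metis
  have "inj_on ?inv A" for A
    using bij by (meson bij_imp_bij_inv bij_is_inj inj_on_subset subset_UNIV)
  then show "\<not> Modules.module.dependent scale (mon_eval g ` standard H \<Sigma>)"
    using Modules.module_hom.independent_injective_image[OF inv_hom indep_lt] by (simp add: image)
  show "Modules.module.span scale (mon_eval g ` standard H \<Sigma>) = UNIV"
    using Modules.module_hom.span_image[OF inv_hom, of "mon_eval g_lt ` standard H \<Sigma>"]
      bij_imp_bij_inv[OF bij] by (simp add: image span_lt bij_is_surj)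
qed

lemma linear_order_finite_max:
  assumes "linear_order_on A ord" "finite U" "U \<noteq> {}" "U \<subseteq> A"
  shows "\<exists>u\<in>U. \<forall>v\<in>U. (v, u) \<in> ord"
  using assms(2,3,4)
proof (induction U rule: finite_ne_induct)
  case (singleton x)
  then show ?case using assms(1) by (auto simp: order_on_defs refl_on_def)
next
  case (insert x U)
  then obtain u where u: "u \<in> U" "\<forall>v\<in>U. (v, u) \<in> ord" by auto
  have "(x, u) \<in> ord \<or> (u, x) \<in> ord"
    using assms(1) insert u by (auto simp: order_on_defs total_on_def)
  moreover have "(x, x) \<in> ord"
    using assms(1) insert by (auto simp: order_on_defs refl_on_def)
  moreover have "trans ord" using assms(1) by (auto simp: order_on_defs)
  then have "\<forall>v\<in>U. (v, x) \<in> ord" if "(u, x) \<in> ord"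
    using u(2) that by (meson transD)
  ultimately show ?case using u by auto
qed

locale standard_basis = Modules.module scale for scale :: "'k::field \<Rightarrow> 'a::comm_ring_1 \<Rightarrow> 'a" +
  fixes H :: "'h set" and g :: "'h \<Rightarrow> 'a" and \<Sigma> :: "'h multiset set"
  assumes inj: "inj_on (mon_eval g) (standard H \<Sigma>)"
    and indep: "independent (mon_eval g ` standard H \<Sigma>)"
    and spanning: "span (mon_eval g ` standard H \<Sigma>) = UNIV"
begin

abbreviation coeff where "coeff \<equiv> std_coeff scale H g \<Sigma>"

abbreviation support where "support f \<equiv> {u \<in> standard H \<Sigma>. coeff f u \<noteq> 0}"

lemma
  shows finite_support: "finite (support f)"
    and standard_expansion: "(\<Sum>u\<in>support f. scale (coeff f u) (mon_eval g u)) = f"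
proof -
  let ?B = "mon_eval g ` standard H \<Sigma>"
  have image: "{b. representation ?B f b \<noteq> 0} = mon_eval g ` support f"
    using representation_ne_zero[of ?B f] by (auto simp: std_coeff_def)
  have inj': "inj_on (mon_eval g) (support f)"
    using inj by (rule inj_on_subset) auto
  show "finite (support f)"
    using finite_representation[of ?B f] inj' unfolding image by (simp add: finite_image_iff)
  have "(\<Sum>b | representation ?B f b \<noteq> 0. scale (representation ?B f b) b) = f"
    by (rule sum_nonzero_representation_eq[OF indep]) (simp add: spanning)
  then show "(\<Sum>u\<in>support f. scale (coeff f u) (mon_eval g u)) = f"
    unfolding image sum.reindex[OF inj'] by (simp add: std_coeff_def o_def)
qed

lemma LM_in_support:
  assumes ord: "linear_order_on (standard H \<Sigma>) ord" and f: "f \<noteq> 0"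
  shows "LM scale H g \<Sigma> ord f \<in> support f"
proof -
  have "support f \<noteq> {}" using standard_expansion[of f] f by (metis sum.empty)
  then obtain u where u: "u \<in> support f" "\<forall>v\<in>support f. (v, u) \<in> ord"
    using linear_order_finite_max[OF ord finite_support] by fastforce
  moreover have "antisym ord" using ord by (simp add: order_on_defs)
  ultimately have "LM scale H g \<Sigma> ord f = u"
    unfolding LM_def by (intro the_equality) (auto dest: antisymD)
  then show ?thesis using u by simp
qed

lemma LT_standard:
  assumes ord: "linear_order_on (standard H \<Sigma>) ord" and u: "u \<in> standard H \<Sigma>"
  shows "LT scale H g \<Sigma> ord (mon_eval g u) = mon_eval g u"
proof -
  have ne: "mon_eval g u \<noteq> 0" using indep u dependent_zero by force
  have coeff: "coeff (mon_eval g u) v = (if v = u then 1 else 0)" if "v \<in> standard H \<Sigma>" for v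
    using representation_basis[OF indep, of "mon_eval g u"] u that inj
    by (auto simp: std_coeff_def dest: inj_onD)
  have "LM scale H g \<Sigma> ord (mon_eval g u) = u"
    using LM_in_support[OF ord ne] coeff by (auto split: if_splits)
  then show ?thesis using ne coeff[OF u] by (simp add: LT_def)
qed

end

section \<open>Standard monomials occurring in elements of the minor ideal\<close>

text \<open>A product of generic matrices of inner dimension \<open>r - 1\<close> has rank less than \<open>r\<close>.\<close>
lemma minor_ideal_low_rank_subst:
  assumes "f \<in> minor_ideal r" "0 < r"
  shows "low_rank_subst (r - 1) f = 0"
proof -
  have "minor_ideal r \<subseteq> {f. low_rank_subst (r - 1) f = 0}"
    unfolding minor_ideal_def ideal_span_def
  proof (rule ring_module.span_minimal)
    show "{minor S T |S T. card S = r \<and> card T = r} \<subseteq> {f. low_rank_subst (r - 1) f = 0}"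
      using assms(2) by (auto intro: low_rank_subst_minor_zero)
    show "ring_module.subspace {f. low_rank_subst (r - 1) f = 0}"
      by (auto simp: ring_module.subspace_def low_rank_subst.hom_add low_rank_subst.hom_mult)
  qed
  then show ?thesis using assms(1) by auto
qed

lemma low_rank_subst_monomial:
  "low_rank_subst N (mon_eval bd_gen u) = prod_mset (image_mset (\<lambda>x. low_rank_subst N (bd_gen x)) u)"
  by (induction u) (simp_all add: mon_eval_def low_rank_subst.hom_mult)

text \<open>
  Apply the low-rank substitution to the standard expansion of \<open>f\<close>. The standard monomials with a
  factor of size at least \<open>r\<close> disappear, the others (collected in \<open>V\<close>) become monic polynomials with
  distinct leading exponents. As \<open>f\<close> itself goes to 0, no monomial of \<open>V\<close> can occur in \<open>f\<close>.
\<close>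
lemma minor_ideal_support_has_large_minor:
  fixes f :: "('m::{finite,linorder}, 'n::{finite,linorder}, 'k::field) matrix_poly"
  assumes basis: "standard_basis poly_scale bd_H (bd_gen :: _ \<Rightarrow> ('m, 'n, 'k) matrix_poly) bd_Sigma"
    and f: "f \<in> minor_ideal r" and r: "0 < r"
    and u: "u \<in> standard bd_H bd_Sigma" "std_coeff poly_scale bd_H bd_gen bd_Sigma f u \<noteq> 0"
  shows "\<exists>(S, T)\<in>#u. r \<le> card S"
proof (rule ccontr)
  interpret standard_basis poly_scale bd_H "bd_gen :: _ \<Rightarrow> ('m, 'n, 'k) matrix_poly" bd_Sigma by (fact basis)
  let ?q = "\<lambda>u. low_rank_subst (r - 1) (mon_eval bd_gen u :: ('m, 'n, 'k) matrix_poly)"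
  define V where "V = {u \<in> support f. \<forall>(S, T)\<in>#u. card S < r}"
  assume "\<not> (\<exists>(S, T)\<in>#u. r \<le> card S)"
  then have "u \<in> V" using u by (auto simp: V_def)
  have factor: "card S = card T" if "(S, T) \<in># v" "v \<in> support f" for S T v
    using that standard_factor_square by blast
  have vanish: "?q v = 0" if v: "v \<in> support f" "v \<notin> V" for v
  proof -
    obtain S T where ST: "(S, T) \<in># v" "r \<le> card S" using v by (auto simp: V_def)
    then have "low_rank_subst (r - 1) (bd_gen (S, T)) = 0"
      using factor v r by (simp add: bd_gen_def low_rank_subst_minor_zero)
    then show ?thesis
      using ST(1) by (force simp: low_rank_subst_monomial prod_mset_zero_iff)
  qed
  have "(\<Sum>v\<in>V. Poly_Mapping.single 0 (coeff f v) * ?q v) =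
      (\<Sum>v\<in>support f. Poly_Mapping.single 0 (coeff f v) * ?q v)"
  proof (rule sum.mono_neutral_left)
    show "finite (support f)" by (rule finite_support)
    show "V \<subseteq> support f" by (auto simp: V_def)
    show "\<forall>v\<in>support f - V. Poly_Mapping.single 0 (coeff f v) * ?q v = 0"
      using vanish by (metis (no_types, lifting) DiffD1 DiffD2 mult_zero_right)
  qed
  also have "\<dots> = low_rank_subst (r - 1) (\<Sum>v\<in>support f. poly_scale (coeff f v) (mon_eval bd_gen v))"
    by (simp add: low_rank_subst_def poly_subst_sum poly_subst_scale)
  also have "\<dots> = 0"
    using minor_ideal_low_rank_subst[OF f r] by (simp add: standard_expansion)
  finally have "(\<Sum>v\<in>V. Poly_Mapping.single 0 (coeff f v) * ?q v) = 0" .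
  moreover have "finite V" unfolding V_def by (rule finite_subset[OF _ finite_support]) blast
  moreover have "inj_on leading_exp V"
    using leading_exp_inj by (rule inj_on_subset) (auto simp: V_def)
  moreover have "monic_at (?q v) (leading_exp v)" if "v \<in> V" for v
    unfolding low_rank_subst_monomial leading_exp_def
  proof (rule monic_at_prod_mset)
    fix x assume x: "x \<in># v"
    obtain S T where [simp]: "x = (S, T)" by (cases x)
    have "card S = card T" "card S < r" using x that factor by (auto simp: V_def)
    then show "monic_at (low_rank_subst (r - 1) (bd_gen x)) (diagonal_exp x)"
      by (simp add: bd_gen_def low_rank_subst_minor_monic)
  qed
  ultimately have "\<forall>v\<in>V. coeff f v = 0"
    by (intro monic_at_independent)
  then show False using \<open>u \<in> V\<close> u(2) by blast
qed

section \<open>The universal bd-Groebner basis\<close>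

theorem theorem7p24:
  fixes r :: nat
    and ord :: "('m::{finite,linorder} set \<times> 'n::{finite,linorder} set) multiset rel"
    and scale_lt :: "'k::field \<Rightarrow> 'b::comm_ring_1 \<Rightarrow> 'b"
    and gen_lt :: "'m set \<times> 'n set \<Rightarrow> 'b"
    and \<pi>_lt :: "('m, 'n, 'k) matrix_poly \<Rightarrow> 'b"
  assumes "CARD('m) > CARD('n)"
    and "CARD('n) \<ge> r"
    and "pseudo_ASL_term_order
           (poly_scale :: 'k \<Rightarrow> ('m, 'n, 'k) matrix_poly \<Rightarrow> _) bd_H bd_gen bd_Sigma ord"
    and "leading_term_algebra poly_scale bd_H bd_gen bd_Sigma ord scale_lt gen_lt \<pi>_lt"
  shows "pseudo_ASL_Groebner_basis poly_scale bd_H bd_gen bd_Sigma ord \<pi>_lt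
           (minor_ideal r) (minors_ge r)"
proof -
  let ?LT = "LT poly_scale bd_H bd_gen bd_Sigma ord :: _ \<Rightarrow> ('m, 'n, 'k) matrix_poly"
  let ?J = "ideal_span {\<pi>_lt (?LT f) |f. f \<in> minors_ge r}"
  have lin: "Vector_Spaces.linear poly_scale scale_lt \<pi>_lt"
    and \<pi>: "\<And>u. u \<in> standard bd_H bd_Sigma \<Longrightarrow> \<pi>_lt (mon_eval bd_gen u) = mon_eval gen_lt u"
    and "pseudo_ASL scale_lt bd_H gen_lt bd_Sigma"
    using assms(4) unfolding leading_term_algebra_def by auto
  then interpret lt: comm_algebra scale_lt by (simp add: pseudo_ASL_def)
  interpret \<pi>: Vector_Spaces.linear poly_scale scale_lt \<pi>_lt by (fact lin)
  interpret standard_basis poly_scale bd_H "bd_gen :: _ \<Rightarrow> ('m, 'n, 'k) matrix_poly" bd_Sigma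
    using leading_term_algebra_standard_basis[OF assms(4)] by unfold_locales
  have ord: "linear_order_on (standard bd_H bd_Sigma) ord"
    using assms(3) by (simp add: pseudo_ASL_term_order_def)
  have sub: "minors_ge r \<subseteq> (minor_ideal r :: ('m, 'n, 'k) matrix_poly set)"
    by (auto simp: minors_ge_def intro: minor_in_minor_ideal)
  have "\<pi>_lt (?LT f) \<in> ?J" if f: "f \<in> minor_ideal r" for f
  proof (cases "f = 0")
    case True
    then show ?thesis by (simp add: LT_def \<pi>.zero ideal_span_def ring_module.span_zero)
  next
    case False
    define u where "u = LM poly_scale bd_H bd_gen bd_Sigma ord f"
    have u: "u \<in> standard bd_H bd_Sigma" "coeff f u \<noteq> 0"
      using LM_in_support[OF ord False] by (auto simp: u_def)
    \<comment> \<open>The witness is one large factor of \<open>u\<close>; for \<open>r = 0\<close> it is the empty monomial, which is the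
      empty minor \<open>1\<close>.\<close>
    obtain w where w: "w \<subseteq># u" "(mon_eval bd_gen w :: ('m, 'n, 'k) matrix_poly) \<in> minors_ge r"
    proof (cases "r = 0")
      case True
      have "(mon_eval bd_gen {#} :: ('m, 'n, 'k) matrix_poly) = minor {} {}"
        by (simp add: mon_eval_def minor_def)
      moreover have "minor {} {} \<in> (minors_ge r :: ('m, 'n, 'k) matrix_poly set)"
        unfolding minors_ge_def by (intro CollectI exI[of _ "{}"]) (simp add: True)
      ultimately show ?thesis using that[of "{#}"] by simp
    next
      case False
      then obtain S T where ST: "(S, T) \<in># u" "r \<le> card S"
        using minor_ideal_support_has_large_minor[OF standard_basis_axioms f _ u] by auto
      have "card S = card T" using standard_factor_square[OF u(1) ST(1)] .
      then have "minor S T \<in> (minors_ge r :: ('m, 'n, 'k) matrix_poly set)"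
        using ST(2) card_mono[of UNIV T] unfolding minors_ge_def
        by (intro CollectI exI[of _ S] exI[of _ T]) simp
      then show ?thesis
        using that[of "{#(S, T)#}"] ST(1) by (simp add: mon_eval_def bd_gen_def)
    qed
    have w_std: "w \<in> standard bd_H bd_Sigma"
      using u(1) set_mset_mono[OF w(1)] unfolding standard_iff by blast
    have "\<pi>_lt (?LT f) = scale_lt (coeff f u) (mon_eval gen_lt u)"
      using False u(1) by (simp add: LT_def u_def[symmetric] \<pi>.scale \<pi>)
    also have "mon_eval gen_lt u = mon_eval gen_lt (u - w) * mon_eval gen_lt w"
      using w(1) by (metis image_mset_union mon_eval_def prod_mset_Un subset_mset.diff_add)
    also have "scale_lt (coeff f u) \<dots> = scale_lt (coeff f u) (mon_eval gen_lt (u - w)) * mon_eval gen_lt w"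
      by (simp add: lt.scale_mult)
    also have "mon_eval gen_lt w = \<pi>_lt (?LT (mon_eval bd_gen w))"
      by (simp add: LT_standard[OF ord w_std] \<pi> w_std)
    finally show ?thesis
      using w(2) unfolding ideal_span_def
      by (simp only:) (intro ring_module.span_scale ring_module.span_base CollectI
        exI[of _ "mon_eval bd_gen w"] conjI refl)
  qed
  then have "ideal_span {\<pi>_lt (?LT f) |f. f \<in> minor_ideal r} \<subseteq> ?J"
    unfolding ideal_span_def by (intro ring_module.span_minimal ring_module.subspace_span) auto
  moreover have "?J \<subseteq> ideal_span {\<pi>_lt (?LT f) |f. f \<in> minor_ideal r}"
    unfolding ideal_span_def using sub by (intro ring_module.span_mono) auto
  ultimately show ?thesis
    using sub by (simp add: pseudo_ASL_Groebner_basis_def)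
qed

end
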